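(* Let $\mathcal{Z}$ be a global durational stochastic game (GDSG) with state set $S_\mathcal{Z}$ and accepting states $Acc_\mathcal{Z}$. Then the procedure Compute_GAMEC($\mathcal{Z}$) (specified in the context) returns all generalized accepting maximal end components (GAMECs) of $\mathcal{Z}$, where each returned state set $N$ is taken together with the action map $D$ computed by the procedure.
   Context: **Timed Büchi automaton (TBA).** Clock constraints over a clock set $C$ are generated by $\phi=\top\mid\bot\mid c\bowtie\delta\mid\phi_1\wedge\phi_2$ with $\bowtie\in\{\le,\ge,<,>\}$, $c\in C$, $\delta\in\mathbb{Q}$ non-negative; $\Phi(C)$ is the set of them. A TBA is $\mathcal{A}=(Q,2^\Pi,q_0,C,\Phi(C),E,F)$ with finite state set $Q$, alphabet $2^\Pi$ over atomic propositions $\Pi$, initial state $q_0$, transitions $E\subseteq Q\times Q\times 2^\Pi\times 2^C\times\Phi(C)$, accepting states $F\subseteq Q$. A valuation $\mathbf{v}$ assigns a value to each clock, and takes values in a set $V\subseteq\mathbb{R}^{|C|}$. Write $(q,\mathbf{v})\xrightarrow{a,\delta}(q',\mathbf{v}')$ if there is a transition $\langle q,q',a,C',\phi\rangle\in E$ with $\mathbf{v}+\delta\models\phi$, $\mathbf{v}'(c)=\mathbf{v}(c)+\delta$ for $c\notin C'$ and $\mathbf{v}'(c)=0$ for $c\in C'$. **Durational stochastic game (DSG)** $\mathcal{G}$: finite state set $S_\mathcal{G}$, initial state $s_{\mathcal{G},0}$, finite action sets $U_C$ (defender) and $U_A$ (adversary), with $U_C(\cdot),U_A(\cdot)$ the actions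 available at a state; transition probabilities $Pr_\mathcal{G}(s'|s,u_C,u_A)$; a finite set $\Delta$ of durations and a probability mass function $T_\mathcal{G}(\delta|s,u_C,u_A,s')$ on $\Delta$; labeling $L:S_\mathcal{G}\to 2^\Pi$; clock set $C$. **Product DSG (PDSG).** Finite state set $S=S_\mathcal{G}\times Q\times V$, accepting states $Acc=S_\mathcal{G}\times F\times V$, and $Pr((s',q',\mathbf{v}')|(s,q,\mathbf{v}),u_C,u_A)=T_\mathcal{G}(\delta|s,u_C,u_A,s')\,Pr_\mathcal{G}(s'|s,u_C,u_A)$ if $(q,\mathbf{v})\xrightarrow{L(s'),\delta}(q',\mathbf{v}')$, and $0$ otherwise. **Finite state controller (FSC)** $\mathcal{F}=(Y,y_0,\mu)$: $Y=\Lambda\times\{0,1\}$ finite set of internal states ($\Lambda$ a set of estimates of clock valuations, the bit indicating whether a timing attack has been detected); $y_0$ initial internal state. Hypothesis $\mathcal{H}_0$: no timing attack detected; $\mathcal{H}_1$: timing attack detected. The defender policy $\mu$ is $\mu_0(y',u_C|s,q,\mathbf{v},y)\in[0,1]$ under $\mathcal{H}_0$ and $\mu_1(y',u_C|s,q,y)\in[0,1]$ under $\mathcal{H}_1$, the probability of moving to internal state $y'$ and taking action $u_C$. A timing attack policy is $\xi(\mathbf{v}'|\mathbf{v})\in[0,1]$, the probability that the adversary changes the correct clock valuation $\mathbf{v}$, as observed by the defender, to $\mathbf{v}'$. **Global DSG (GDSG)** $\mathcal{Z}$: finite state set $S_\mathcal{Z}=S\times Y$, action sets $U_C,U_A$,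 accepting states $Acc_\mathcal{Z}=Acc\times Y$, and $Pr_\mathcal{Z}((s',q',\mathbf{v}',y')|(s,q,\mathbf{v},y),u_C,u_A)$ equal to $\sum_{\mathbf{v}''}\xi(\mathbf{v}''|\mathbf{v})\,\mu_0(y',u_C|s,q,\mathbf{v}'',y)\,Pr((s',q',\mathbf{v}')|(s,q,\mathbf{v}),u_C,u_A)$ under $\mathcal{H}_0$, and $\mu_1(y',u_C|s,q,y)\,T_\mathcal{G}(\delta|s,u_C,u_A,s')\,Pr_\mathcal{G}(s'|s,u_C,u_A)$ under $\mathcal{H}_1$, where a transition exists only if $(q,\mathbf{v})\xrightarrow{L(s'),\delta}(q',\mathbf{v}')$ (probability $0$ otherwise). **End components.** A sub-DSG of $\mathcal{Z}$ is a pair $(N,D)$ with $\emptyset\ne N\subseteq S_\mathcal{Z}$ and $D:N\to 2^{U_C}$ such that $D(\mathfrak{s})\subseteq U_C(\mathfrak{s})$ for all $\mathfrak{s}\in N$ and, for all $\mathfrak{s}\in N$ and $u_C\in D(\mathfrak{s})$, all states reached from $\mathfrak{s}$ with positive probability under $u_C$ and any $u_A\in U_A(\mathfrak{s})$ lie in $N$. A generalized end component (GEC) is a sub-DSG whose underlying directed graph $G_{(N,D)}$ is strongly connected. A generalized maximal end component (GMEC) is a GEC $(N,D)$ such that there is no other GEC $(N',D')\ne(N,D)$ with $N\subseteq N'$ and $D(\mathfrak{s})\subseteq D'(\mathfrak{s})$ for all $\mathfrak{s}\in N$. A GAMEC is a GMEC with $Acc_\mathcal{Z}\cap N\ne\emptyset$.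 **Procedure Compute_GAMEC($\mathcal{Z}$).** Initialize $D(\mathfrak{s})\leftarrow U_C(\mathfrak{s})$ for all $\mathfrak{s}\in S_\mathcal{Z}$, $\mathcal{C}\leftarrow\emptyset$, $\mathcal{C}_{temp}\leftarrow\{S_\mathcal{Z}\}$. Repeat until $\mathcal{C}=\mathcal{C}_{temp}$: (1) $\mathcal{C}\leftarrow\mathcal{C}_{temp}$, $\mathcal{C}_{temp}\leftarrow\emptyset$. (2) For each $N\in\mathcal{C}$: set $R\leftarrow\emptyset$; let $SCC_1,\dots,SCC_n$ be the strongly connected components of the directed graph $G_{(N,D)}$. (2a) For $i=1,\dots,n$ and each $\mathfrak{s}\in SCC_i$: set $D(\mathfrak{s})$ to be the set of $u_C\in U_C(\mathfrak{s})$ such that, for all $u_A\in U_A(\mathfrak{s})$, the states $\mathfrak{s}'$ with $Pr_\mathcal{Z}(\mathfrak{s}'|\mathfrak{s},u_C,u_A)>0$ lie in $N$; if $D(\mathfrak{s})=\emptyset$, add $\mathfrak{s}$ to $R$. (2b) While $R\neq\emptyset$: remove some $\mathfrak{s}\in R$ from both $R$ and $N$; for $\mathfrak{s}'\in N$ and $u_C\in U_C(\mathfrak{s}')$ with $Pr_\mathcal{Z}(\mathfrak{s}|\mathfrak{s}',u_C,u_A)>0$ for some $u_A\in U_A(\mathfrak{s}')$, set $D(\mathfrak{s}')\leftarrow D(\mathfrak{s}')\setminus\{u_C\}$, and if $D(\mathfrak{s}')=\emptyset$, add $\mathfrak{s}'$ to $R$. (2c) For $i=1,\dots,n$: if $N\cap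 SCC_i\neq\emptyset$, set $\mathcal{C}_{temp}\leftarrow\mathcal{C}_{temp}\cup\{N\cap SCC_i\}$. After the repeat loop: for each $N\in\mathcal{C}$ with $Acc_\mathcal{Z}\cap N=\emptyset$, remove $N$ from $\mathcal{C}$. Return $\mathcal{C}$.
   Formalization: In the procedure's graph G_(N,D), actions that may leave N give no edges, and strong connectivity (of GECs and SCCs) needs paths with at least one edge, so single states without a self-loop do not count; with leaving edges or empty paths the claim is false. *)

theory Defs
  imports "HOL-Probability.Probability_Mass_Function"
begin

section \<open>Timed automata\<close>

datatype cmp = LE | GE | LT | GT

datatype 'c clock_constraint =
    CTrue
  | CFalse
  | Atom 'c cmp rat
  | Conj "'c clock_constraint" "'c clock_constraint"

inductive_set constraints :: "'c set \<Rightarrow> 'c clock_constraint set" for C where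
  "CTrue \<in> constraints C"
| "CFalse \<in> constraints C"
| "c \<in> C \<Longrightarrow> 0 \<le> d \<Longrightarrow> Atom c r d \<in> constraints C"
| "\<phi> \<in> constraints C \<Longrightarrow> \<psi> \<in> constraints C \<Longrightarrow> Conj \<phi> \<psi> \<in> constraints C"

fun compares :: "cmp \<Rightarrow> real \<Rightarrow> real \<Rightarrow> bool" where
  "compares LE x y \<longleftrightarrow> x \<le> y"
| "compares GE x y \<longleftrightarrow> x \<ge> y"
| "compares LT x y \<longleftrightarrow> x < y"
| "compares GT x y \<longleftrightarrow> x > y"

fun sat :: "('c \<Rightarrow> real) \<Rightarrow> 'c clock_constraint \<Rightarrow> bool" where
  "sat v CTrue \<longleftrightarrow> True"
| "sat v CFalse \<longleftrightarrow> False"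
| "sat v (Atom c r d) \<longleftrightarrow> compares r (v c) (of_rat d)"
| "sat v (Conj \<phi> \<psi>) \<longleftrightarrow> sat v \<phi> \<and> sat v \<psi>"

record ('q, 'p, 'c) tba =
  locs :: "'q set"
  props :: "'p set"
  init_loc :: 'q
  clocks :: "'c set"
  edges :: "('q \<times> 'q \<times> 'p set \<times> 'c set \<times> 'c clock_constraint) set"
  acc_locs :: "'q set"

definition is_tba :: "('q, 'p, 'c) tba \<Rightarrow> bool" where
  "is_tba A \<longleftrightarrow>
     finite (locs A) \<and> finite (clocks A) \<and> init_loc A \<in> locs A \<and>
     edges A \<subseteq> locs A \<times> locs A \<times> Pow (props A) \<times> Pow (clocks A) \<times> constraints (clocks A) \<and>
     acc_locs A \<subseteq> locs A"

text \<open>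
  Valuations over a clock set \<open>C\<close> are the extensional functions \<open>C \<rightarrow>\<^sub>E UNIV\<close>, so that they are
  determined by their values on \<open>C\<close>.
\<close>

definition tba_step ::
  "('q, 'p, 'c) tba \<Rightarrow> 'q \<times> ('c \<Rightarrow> real) \<Rightarrow> 'p set \<Rightarrow> real \<Rightarrow> 'q \<times> ('c \<Rightarrow> real) \<Rightarrow> bool" where
  "tba_step A = (\<lambda>(q, v) a \<delta> (q', v').
     \<exists>C' \<phi>. (q, q', a, C', \<phi>) \<in> edges A \<and> sat (\<lambda>c. v c + \<delta>) \<phi> \<and>
       (\<forall>c\<in>clocks A. v' c = (if c \<in> C' then 0 else v c + \<delta>)))"


section \<open>Durational stochastic games\<close>

record ('s, 'uc, 'ua, 'p, 'c) dsg =
  dsg_states :: "'s set"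
  dsg_init :: 's
  dsg_UC :: "'uc set"
  dsg_UA :: "'ua set"
  dsg_avC :: "'s \<Rightarrow> 'uc set"
  dsg_avA :: "'s \<Rightarrow> 'ua set"
  dsg_Pr :: "'s \<Rightarrow> 'uc \<Rightarrow> 'ua \<Rightarrow> 's pmf"
  durations :: "real set"
  dsg_T :: "'s \<Rightarrow> 'uc \<Rightarrow> 'ua \<Rightarrow> 's \<Rightarrow> real pmf"
  label :: "'s \<Rightarrow> 'p set"
  dsg_clocks :: "'c set"

definition is_dsg :: "('s, 'uc, 'ua, 'p, 'c) dsg \<Rightarrow> bool" where
  "is_dsg G \<longleftrightarrow>
     finite (dsg_states G) \<and> dsg_init G \<in> dsg_states G \<and>
     finite (dsg_UC G) \<and> finite (dsg_UA G) \<and>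
     finite (durations G) \<and> (\<forall>\<delta>\<in>durations G. 0 \<le> \<delta>) \<and>
     finite (dsg_clocks G) \<and>
     (\<forall>s\<in>dsg_states G.
        dsg_avC G s \<subseteq> dsg_UC G \<and> dsg_avA G s \<subseteq> dsg_UA G \<and>
        (\<forall>u\<in>dsg_avC G s. \<forall>a\<in>dsg_avA G s.
           set_pmf (dsg_Pr G s u a) \<subseteq> dsg_states G \<and>
           (\<forall>s'\<in>dsg_states G. set_pmf (dsg_T G s u a s') \<subseteq> durations G)))"

text \<open>
  The product and the global game have transition weights that need not sum to one (a run of the
  automaton may block, and the controller's choice of action is part of the weight), hence the
  real-valued transition function.
\<close>

record ('x, 'uc, 'ua) game =
  states :: "'x set"
  UC :: "'uc set"
  UA :: "'ua set"
  avC :: "'x \<Rightarrow> 'uc set"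
  avA :: "'x \<Rightarrow> 'ua set"
  trans_pr :: "'x \<Rightarrow> 'uc \<Rightarrow> 'ua \<Rightarrow> 'x \<Rightarrow> real"
  acc :: "'x set"

type_synonym ('s, 'q, 'c) pstate = "'s \<times> 'q \<times> ('c \<Rightarrow> real)"

text \<open>
  Several durations may lead to the same successor, for instance when all clocks are reset; the
  weight of the successor is the total over these durations.
\<close>

definition pdsg_pr ::
  "('q, 'p, 'c) tba \<Rightarrow> ('s, 'uc, 'ua, 'p, 'c) dsg \<Rightarrow>
   ('s, 'q, 'c) pstate \<Rightarrow> 'uc \<Rightarrow> 'ua \<Rightarrow> ('s, 'q, 'c) pstate \<Rightarrow> real" where
  "pdsg_pr A G = (\<lambda>(s, q, v) u a (s', q', v').
     \<Sum>\<delta>\<in>durations G.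
       if tba_step A (q, v) (label G s') \<delta> (q', v')
       then pmf (dsg_T G s u a s') \<delta> * pmf (dsg_Pr G s u a) s' else 0)"

definition pdsg ::
  "('q, 'p, 'c) tba \<Rightarrow> ('s, 'uc, 'ua, 'p, 'c) dsg \<Rightarrow> ('c \<Rightarrow> real) set \<Rightarrow>
   (('s, 'q, 'c) pstate, 'uc, 'ua) game" where
  "pdsg A G V = \<lparr>
     states = dsg_states G \<times> locs A \<times> V,
     UC = dsg_UC G, UA = dsg_UA G,
     avC = (\<lambda>(s, q, v). dsg_avC G s), avA = (\<lambda>(s, q, v). dsg_avA G s),
     trans_pr = pdsg_pr A G,
     acc = dsg_states G \<times> acc_locs A \<times> V\<rparr>"


section \<open>Controllers, timing attacks and the global game\<close>

text \<open>
  An internal state is a pair of an estimate and the bit telling whether a timing attack has been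
  detected. How estimates represent valuations is immaterial, so their type is left open.
\<close>

record ('s, 'q, 'c, 'l, 'uc) fsc =
  estimates :: "'l set"
  fsc_init :: "'l \<times> bool"
  mu0 :: "'s \<Rightarrow> 'q \<Rightarrow> ('c \<Rightarrow> real) \<Rightarrow> 'l \<times> bool \<Rightarrow> (('l \<times> bool) \<times> 'uc) pmf"
  mu1 :: "'s \<Rightarrow> 'q \<Rightarrow> 'l \<times> bool \<Rightarrow> (('l \<times> bool) \<times> 'uc) pmf"

definition internal :: "('s, 'q, 'c, 'l, 'uc) fsc \<Rightarrow> ('l \<times> bool) set" where
  "internal K = estimates K \<times> UNIV"

definition is_fsc ::
  "('q, 'p, 'c) tba \<Rightarrow> ('s, 'uc, 'ua, 'p, 'c) dsg \<Rightarrow> ('c \<Rightarrow> real) set \<Rightarrow>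
   ('s, 'q, 'c, 'l, 'uc) fsc \<Rightarrow> bool" where
  "is_fsc A G V K \<longleftrightarrow>
     finite (estimates K) \<and> fsc_init K \<in> internal K \<and>
     (\<forall>s\<in>dsg_states G. \<forall>q\<in>locs A. \<forall>y\<in>internal K.
        (\<forall>v\<in>V. set_pmf (mu0 K s q v y) \<subseteq> internal K \<times> dsg_avC G s) \<and>
        set_pmf (mu1 K s q y) \<subseteq> internal K \<times> dsg_avC G s)"

text \<open>
  The hypothesis in force at a global state is the one recorded by the bit of its internal state.
\<close>

definition gdsg_pr ::
  "('q, 'p, 'c) tba \<Rightarrow> ('s, 'uc, 'ua, 'p, 'c) dsg \<Rightarrow> ('c \<Rightarrow> real) set \<Rightarrow>
   ('s, 'q, 'c, 'l, 'uc) fsc \<Rightarrow> (('c \<Rightarrow> real) \<Rightarrow> ('c \<Rightarrow> real) pmf) \<Rightarrow>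
   ('s, 'q, 'c) pstate \<times> ('l \<times> bool) \<Rightarrow> 'uc \<Rightarrow> 'ua \<Rightarrow>
   ('s, 'q, 'c) pstate \<times> ('l \<times> bool) \<Rightarrow> real" where
  "gdsg_pr A G V K \<xi> = (\<lambda>((s, q, v), (l, detected)) u a ((s', q', v'), y').
     if \<not> detected
     then \<Sum>v''\<in>V. pmf (\<xi> v) v'' * pmf (mu0 K s q v'' (l, detected)) (y', u) *
            trans_pr (pdsg A G V) (s, q, v) u a (s', q', v')
     else pmf (mu1 K s q (l, detected)) (y', u) *
            trans_pr (pdsg A G V) (s, q, v) u a (s', q', v'))"

definition gdsg ::
  "('q, 'p, 'c) tba \<Rightarrow> ('s, 'uc, 'ua, 'p, 'c) dsg \<Rightarrow> ('c \<Rightarrow> real) set \<Rightarrow>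
   ('s, 'q, 'c, 'l, 'uc) fsc \<Rightarrow> (('c \<Rightarrow> real) \<Rightarrow> ('c \<Rightarrow> real) pmf) \<Rightarrow>
   (('s, 'q, 'c) pstate \<times> ('l \<times> bool), 'uc, 'ua) game" where
  "gdsg A G V K \<xi> = \<lparr>
     states = states (pdsg A G V) \<times> internal K,
     UC = dsg_UC G, UA = dsg_UA G,
     avC = (\<lambda>(x, y). avC (pdsg A G V) x), avA = (\<lambda>(x, y). avA (pdsg A G V) x),
     trans_pr = gdsg_pr A G V K \<xi>,
     acc = acc (pdsg A G V) \<times> internal K\<rparr>"

definition gdsg_data ::
  "('q, 'p, 'c) tba \<Rightarrow> ('s, 'uc, 'ua, 'p, 'c) dsg \<Rightarrow> ('c \<Rightarrow> real) set \<Rightarrow>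
   ('s, 'q, 'c, 'l, 'uc) fsc \<Rightarrow> (('c \<Rightarrow> real) \<Rightarrow> ('c \<Rightarrow> real) pmf) \<Rightarrow> bool" where
  "gdsg_data A G V K \<xi> \<longleftrightarrow>
     is_tba A \<and> is_dsg G \<and> dsg_clocks G = clocks A \<and>
     (\<forall>s\<in>dsg_states G. label G s \<subseteq> props A) \<and>
     finite V \<and> V \<subseteq> (clocks A \<rightarrow>\<^sub>E UNIV) \<and>
     is_fsc A G V K \<and> (\<forall>v\<in>V. set_pmf (\<xi> v) \<subseteq> V)"


section \<open>End components\<close>

definition succs :: "('x, 'uc, 'ua) game \<Rightarrow> 'x \<Rightarrow> 'uc \<Rightarrow> 'x set" where
  "succs Z x u = {x' \<in> states Z. \<exists>a\<in>avA Z x. trans_pr Z x u a x' > 0}"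

definition sub_dsg :: "('x, 'uc, 'ua) game \<Rightarrow> 'x set \<Rightarrow> ('x \<Rightarrow> 'uc set) \<Rightarrow> bool" where
  "sub_dsg Z N D \<longleftrightarrow>
     N \<noteq> {} \<and> N \<subseteq> states Z \<and> D \<in> (\<Pi>\<^sub>E x\<in>N. Pow (avC Z x)) \<and>
     (\<forall>x\<in>N. \<forall>u\<in>D x. succs Z x u \<subseteq> N)"

text \<open>
  The directed graph of \<open>(N, D)\<close>, where \<open>D\<close> need not be closed in \<open>N\<close>: an action that may leave
  \<open>N\<close> belongs to no sub-DSG with state set \<open>N\<close> and contributes no edge. On sub-DSGs this is the
  plain graph of positive-probability transitions (lemma below). The distinction matters for the
  procedure: with the edges of leaving actions it can stop while the action sets just recomputed
  no longer connect a component.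
\<close>

definition digraph ::
  "('x, 'uc, 'ua) game \<Rightarrow> 'x set \<Rightarrow> ('x \<Rightarrow> 'uc set) \<Rightarrow> ('x \<times> 'x) set" where
  "digraph Z N D =
     {(x, x'). x \<in> N \<and> x' \<in> N \<and> (\<exists>u\<in>D x. succs Z x u \<subseteq> N \<and> x' \<in> succs Z x u)}"

lemma digraph_sub_dsg:
  assumes "sub_dsg Z N D"
  shows "digraph Z N D = {(x, x'). x \<in> N \<and> (\<exists>u\<in>D x. x' \<in> succs Z x u)}"
  using assms unfolding digraph_def sub_dsg_def by blast

text \<open>
  Paths have at least one edge: a single vertex is strongly connected only if it has a self-loop,
  as is usual for end components, where the play has to be able to remain in the component.
\<close>

definition strongly_connected :: "'v set \<Rightarrow> ('v \<times> 'v) set \<Rightarrow> bool" where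
  "strongly_connected X E \<longleftrightarrow>
     X \<noteq> {} \<and> (\<forall>x\<in>X. \<forall>y\<in>X. (x, y) \<in> (E \<inter> X \<times> X)\<^sup>+)"

definition sccs :: "'v set \<Rightarrow> ('v \<times> 'v) set \<Rightarrow> 'v set set" where
  "sccs N E =
     {X. X \<subseteq> N \<and> strongly_connected X E \<and>
         \<not> (\<exists>X'. X \<subset> X' \<and> X' \<subseteq> N \<and> strongly_connected X' E)}"

definition gec :: "('x, 'uc, 'ua) game \<Rightarrow> 'x set \<Rightarrow> ('x \<Rightarrow> 'uc set) \<Rightarrow> bool" where
  "gec Z N D \<longleftrightarrow> sub_dsg Z N D \<and> strongly_connected N (digraph Z N D)"

definition gmec :: "('x, 'uc, 'ua) game \<Rightarrow> 'x set \<Rightarrow> ('x \<Rightarrow> 'uc set) \<Rightarrow> bool" where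
  "gmec Z N D \<longleftrightarrow> gec Z N D \<and>
     \<not> (\<exists>N' D'. gec Z N' D' \<and> (N', D') \<noteq> (N, D) \<and> N \<subseteq> N' \<and> (\<forall>x\<in>N. D x \<subseteq> D' x))"

definition gamec :: "('x, 'uc, 'ua) game \<Rightarrow> 'x set \<Rightarrow> ('x \<Rightarrow> 'uc set) \<Rightarrow> bool" where
  "gamec Z N D \<longleftrightarrow> gmec Z N D \<and> acc Z \<inter> N \<noteq> {}"


section \<open>The procedure\<close>

text \<open>
  Loops are functions into \<open>option\<close>, where \<open>None\<close> stands for non-termination. The procedure leaves
  two choices open: the element \<open>pick N R\<close> taken out of \<open>R\<close> (as \<open>N\<close> shrinks in each iteration,
  every run of that loop is realised by some \<open>pick\<close>), and the order \<open>visit \<C>\<close> in which the members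
  of \<open>\<C>\<close> are visited.
\<close>

definition valid_pick :: "('x set \<Rightarrow> 'x set \<Rightarrow> 'x) \<Rightarrow> bool" where
  "valid_pick pick \<longleftrightarrow> (\<forall>N R. R \<noteq> {} \<longrightarrow> pick N R \<in> R)"

definition valid_visit :: "('x set set \<Rightarrow> 'x set list) \<Rightarrow> bool" where
  "valid_visit visit \<longleftrightarrow> (\<forall>\<C>. finite \<C> \<longrightarrow> set (visit \<C>) = \<C> \<and> distinct (visit \<C>))"

partial_function (option) prune ::
  "('x, 'uc, 'ua) game \<Rightarrow> ('x set \<Rightarrow> 'x set \<Rightarrow> 'x) \<Rightarrow>
   'x set \<Rightarrow> 'x set \<Rightarrow> ('x \<Rightarrow> 'uc set) \<Rightarrow> ('x set \<times> ('x \<Rightarrow> 'uc set)) option" where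
  "prune Z pick R N D =
     (if R = {} then Some (N, D)
      else let
          x = pick N R;
          N' = N - {x};
          bad = (\<lambda>x'. {u \<in> avC Z x'. x \<in> succs Z x' u});
          D' = (\<lambda>x'. if x' \<in> N' then D x' - bad x' else D x');
          R' = (R - {x}) \<union> {x' \<in> N'. bad x' \<noteq> {} \<and> D' x' = {}}
        in prune Z pick R' N' D')"

text \<open>
  States of \<open>N\<close> outside every strongly connected component (in the sense above) do not enter the
  new family.
\<close>

definition refine ::
  "('x, 'uc, 'ua) game \<Rightarrow> ('x set \<Rightarrow> 'x set \<Rightarrow> 'x) \<Rightarrow> 'x set \<Rightarrow>
   'x set set \<times> ('x \<Rightarrow> 'uc set) \<Rightarrow> ('x set set \<times> ('x \<Rightarrow> 'uc set)) option" where
  "refine Z pick N = (\<lambda>(\<C>\<^sub>t, D).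
     let
       SCCs = sccs N (digraph Z N D);
       D' = (\<lambda>x. if x \<in> \<Union> SCCs then {u \<in> avC Z x. succs Z x u \<subseteq> N} else D x);
       R = {x \<in> \<Union> SCCs. D' x = {}}
     in Option.bind (prune Z pick R N D') (\<lambda>(N', D'').
          Some (\<C>\<^sub>t \<union> {N' \<inter> X |X. X \<in> SCCs \<and> N' \<inter> X \<noteq> {}}, D'')))"

fun refine_all ::
  "('x, 'uc, 'ua) game \<Rightarrow> ('x set \<Rightarrow> 'x set \<Rightarrow> 'x) \<Rightarrow> 'x set list \<Rightarrow>
   'x set set \<times> ('x \<Rightarrow> 'uc set) \<Rightarrow> ('x set set \<times> ('x \<Rightarrow> 'uc set)) option" where
  "refine_all Z pick [] st = Some st"
| "refine_all Z pick (N # Ns) st = Option.bind (refine Z pick N st) (refine_all Z pick Ns)"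

text \<open>The repeat loop, entered with \<open>\<C>\<^sub>t\<close> as the current value of \<open>\<C>\<^sub>t\<^sub>e\<^sub>m\<^sub>p\<close>.\<close>

partial_function (option) repeat_loop ::
  "('x, 'uc, 'ua) game \<Rightarrow> ('x set \<Rightarrow> 'x set \<Rightarrow> 'x) \<Rightarrow> ('x set set \<Rightarrow> 'x set list) \<Rightarrow>
   'x set set \<Rightarrow> ('x \<Rightarrow> 'uc set) \<Rightarrow> ('x set set \<times> ('x \<Rightarrow> 'uc set)) option" where
  "repeat_loop Z pick visit \<C>\<^sub>t D =
     (let \<C> = \<C>\<^sub>t in
      Option.bind (refine_all Z pick (visit \<C>) ({}, D)) (\<lambda>(\<C>\<^sub>t', D').
        if \<C> = \<C>\<^sub>t' then Some (\<C>, D') else repeat_loop Z pick visit \<C>\<^sub>t' D'))"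

definition compute_gamec ::
  "('x, 'uc, 'ua) game \<Rightarrow> ('x set \<Rightarrow> 'x set \<Rightarrow> 'x) \<Rightarrow> ('x set set \<Rightarrow> 'x set list) \<Rightarrow>
   ('x set set \<times> ('x \<Rightarrow> 'uc set)) option" where
  "compute_gamec Z pick visit =
     Option.bind (repeat_loop Z pick visit {states Z} (avC Z))
       (\<lambda>(\<C>, D). Some ({N \<in> \<C>. acc Z \<inter> N \<noteq> {}}, D))"

end

theory Submission
  imports Defs
begin

text \<open>
  Throughout, every generalized end component \<open>(M, E)\<close> stays inside one member of the current family
  and \<open>E\<close> stays below the current action map: a strongly connected set cannot be split by
  components, and its actions never lead to a removed state. The families are disjoint and each
  refines the previous one, so the loop stops. When it stops, no state of a member was removed,
  hence its actions are all those that stay in the member. So the members are themselves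
  generalized end components, and the invariant makes them exactly the maximal ones.
\<close>

section \<open>Strongly connected components\<close>

lemma strongly_connected_mono:
  assumes "strongly_connected X E" and "E \<inter> X \<times> X \<subseteq> E'"
  shows "strongly_connected X E'"
proof -
  have "(E \<inter> X \<times> X)\<^sup>+ \<subseteq> (E' \<inter> X \<times> X)\<^sup>+"
    using assms(2) by (intro trancl_mono_subset) auto
  then show ?thesis
    using assms(1) unfolding strongly_connected_def by blast
qed

text \<open>A common vertex \<open>z\<close> is joined to every vertex in both directions, so paths
  concatenate at \<open>z\<close>.\<close>

lemma strongly_connected_Un:
  assumes X: "strongly_connected X E" and Y: "strongly_connected Y E" and "X \<inter> Y \<noteq> {}"
  shows "strongly_connected (X \<union> Y) E"
proof -
  let ?T = "(E \<inter> (X \<union> Y) \<times> (X \<union> Y))\<^sup>+"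
  have "(E \<inter> X \<times> X)\<^sup>+ \<subseteq> ?T" "(E \<inter> Y \<times> Y)\<^sup>+ \<subseteq> ?T"
    by (intro trancl_mono_subset; blast)+
  then have "X \<times> X \<subseteq> ?T" "Y \<times> Y \<subseteq> ?T"
    using X Y unfolding strongly_connected_def by blast+
  obtain z where z: "z \<in> X" "z \<in> Y"
    using assms(3) by blast
  have "(x, z) \<in> ?T" "(z, x) \<in> ?T" if "x \<in> X \<union> Y" for x
    using that z \<open>X \<times> X \<subseteq> ?T\<close> \<open>Y \<times> Y \<subseteq> ?T\<close> by blast+
  then show ?thesis
    using z unfolding strongly_connected_def by (blast intro: trancl_trans)
qed

text \<open>Overlapping components would merge into a strongly connected set strictly above one of
  them, against maximality.\<close>

lemma disjoint_sccs: "disjoint (sccs N E)"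
proof (rule disjointI)
  fix X Y
  assume X: "X \<in> sccs N E" and Y: "Y \<in> sccs N E" and "X \<noteq> Y"
  show "X \<inter> Y = {}"
  proof (rule ccontr)
    assume "X \<inter> Y \<noteq> {}"
    then have "strongly_connected (X \<union> Y) E"
      using strongly_connected_Un[of X E Y] X Y unfolding sccs_def by simp
    moreover have "X \<union> Y \<subseteq> N" "X \<subset> X \<union> Y \<or> Y \<subset> X \<union> Y"
      using X Y \<open>X \<noteq> Y\<close> unfolding sccs_def by blast+
    ultimately show False
      using X Y unfolding sccs_def by blast
  qed
qed

text \<open>Components need not cover \<open>N\<close>, as states on no closed path are left out. A
  strongly connected \<open>M\<close> is covered: in a finite \<open>N\<close> it extends to a
  maximal such set.\<close>

lemma strongly_connected_subset_scc:
  assumes "finite N" "M \<subseteq> N" "strongly_connected M E"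
  shows "\<exists>X\<in>sccs N E. M \<subseteq> X"
proof -
  let ?S = "{X. X \<subseteq> N \<and> strongly_connected X E}"
  have "finite ?S"
    using assms(1) by auto
  moreover have "M \<in> ?S"
    using assms by blast
  ultimately obtain X where "X \<in> ?S" "M \<subseteq> X" "\<And>Y. Y \<in> ?S \<Longrightarrow> X \<subseteq> Y \<Longrightarrow> X = Y"
    using finite_has_maximal2[of ?S M] by metis
  then show ?thesis
    unfolding sccs_def by blast
qed

section \<open>Generalized end components\<close>

text \<open>The closed path at \<open>x\<close> has at least one edge, and its first edge needs an
  action. This keeps states of end components out of \<open>R\<close>.\<close>

lemma gec_action_nonempty:
  assumes "gec Z M E" "x \<in> M"
  shows "E x \<noteq> {}"
proof -
  have "(x, x) \<in> (digraph Z M E \<inter> M \<times> M)\<^sup>+"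
    using assms unfolding gec_def strongly_connected_def by blast
  then obtain y where "(x, y) \<in> digraph Z M E"
    by (metis IntD1 tranclD)
  then show ?thesis
    unfolding digraph_def by blast
qed

lemma gec_succs: "gec Z M E \<Longrightarrow> x \<in> M \<Longrightarrow> u \<in> E x \<Longrightarrow> succs Z x u \<subseteq> M"
  unfolding gec_def sub_dsg_def by blast

lemma gec_avC: "gec Z M E \<Longrightarrow> x \<in> M \<Longrightarrow> E x \<subseteq> avC Z x"
  unfolding gec_def sub_dsg_def by blast

text \<open>An action that stays in \<open>M\<close> also stays in the larger \<open>N\<close>, so
  every edge of the end component persists in the current graph.\<close>

lemma gec_strongly_connected:
  assumes "gec Z M E" "M \<subseteq> N" "\<And>x. x \<in> M \<Longrightarrow> E x \<subseteq> D x"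
  shows "strongly_connected M (digraph Z N D)"
proof (rule strongly_connected_mono)
  show "strongly_connected M (digraph Z M E)"
    using assms(1) unfolding gec_def by blast
  show "digraph Z M E \<inter> M \<times> M \<subseteq> digraph Z N D"
    using assms(2,3) unfolding digraph_def by blast
qed

section \<open>One round of the procedure\<close>

text \<open>Induction on \<open>card N\<close>. For the last conjunct: the removed state lies in
  \<open>R\<close>, hence outside \<open>M\<close>, and actions of \<open>E\<close> never leave
  \<open>M\<close>. So none of them is deleted, and no state of \<open>M\<close> runs out of
  actions.\<close>

lemma prune_terminates:
  assumes "valid_pick pick" "finite N" "R \<subseteq> N"
  shows "\<exists>N' D'. prune Z pick R N D = Some (N', D') \<and> N' \<subseteq> N - R \<and>
    (\<forall>x. D' x \<subseteq> D x) \<and> (\<forall>x. x \<notin> N \<longrightarrow> D' x = D x) \<and> (N' = N \<longrightarrow> D' = D) \<and>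
    (\<forall>M E. gec Z M E \<longrightarrow> M \<subseteq> N - R \<longrightarrow> (\<forall>x\<in>M. E x \<subseteq> D x) \<longrightarrow>
       M \<subseteq> N' \<and> (\<forall>x\<in>M. E x \<subseteq> D' x))"
  using assms(2,3)
proof (induction "card N" arbitrary: N R D rule: less_induct)
  case less
  show ?case
  proof (cases "R = {}")
    case True
    then show ?thesis
      by (subst prune.simps) auto
  next
    case False
    define x where "x = pick N R"
    have x: "x \<in> R" "x \<in> N"
      using assms(1) False less.prems unfolding x_def valid_pick_def by auto
    define N1 where "N1 = N - {x}"
    define bad where "bad = (\<lambda>x'. {u \<in> avC Z x'. x \<in> succs Z x' u})"
    define D1 where "D1 = (\<lambda>x'. if x' \<in> N1 then D x' - bad x' else D x')"
    define R1 where "R1 = (R - {x}) \<union> {x' \<in> N1. bad x' \<noteq> {} \<and> D1 x' = {}}"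
    have step: "prune Z pick R N D = prune Z pick R1 N1 D1"
      unfolding R1_def D1_def bad_def N1_def x_def
      using False by (subst prune.simps) (simp add: Let_def)
    have "card N1 < card N"
      unfolding N1_def using less.prems x by (meson card_Diff1_less)
    moreover have "finite N1" "R1 \<subseteq> N1"
      using less.prems unfolding N1_def R1_def by auto
    ultimately obtain N' D' where
      run: "prune Z pick R1 N1 D1 = Some (N', D')" and
      sub: "N' \<subseteq> N1 - R1" and
      le: "\<And>y. D' y \<subseteq> D1 y" and
      same: "\<And>y. y \<notin> N1 \<Longrightarrow> D' y = D1 y" and
      cap: "\<And>M E. gec Z M E \<Longrightarrow> M \<subseteq> N1 - R1 \<Longrightarrow> (\<And>x. x \<in> M \<Longrightarrow> E x \<subseteq> D1 x) \<Longrightarrow>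
         M \<subseteq> N' \<and> (\<forall>x\<in>M. E x \<subseteq> D' x)"
      using less.hyps[of N1 R1 D1] by metis
    \<comment> \<open>Since \<open>x\<close> has been removed, the clause for \<open>N' = N\<close>
      is vacuous in this case.\<close>
    have "N' \<subseteq> N - R" "N' \<noteq> N"
      using sub x unfolding N1_def R1_def by auto
    moreover have "D' y \<subseteq> D y" for y
      using le[of y] unfolding D1_def by (auto split: if_splits)
    moreover have "D' y = D y" if "y \<notin> N" for y
      using same[of y] that unfolding D1_def N1_def by auto
    moreover have "M \<subseteq> N' \<and> (\<forall>y\<in>M. E y \<subseteq> D' y)"
      if M: "gec Z M E" "M \<subseteq> N - R" "\<forall>y\<in>M. E y \<subseteq> D y" for M E
    proof (rule cap[OF M(1)])
      have "M \<subseteq> N1"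
        using M(2) x unfolding N1_def by auto
      show D1: "E y \<subseteq> D1 y" if "y \<in> M" for y
        using gec_succs[OF M(1) that] M(2,3) x that unfolding D1_def bad_def by auto
      have "D1 y \<noteq> {}" if "y \<in> M" for y
        using D1[OF that] gec_action_nonempty[OF M(1) that] by auto
      then show "M \<subseteq> N1 - R1"
        using M(2) \<open>M \<subseteq> N1\<close> unfolding R1_def by auto
    qed
    ultimately show ?thesis
      using step run by auto
  qed
qed

section \<open>Contract of a round\<close>

text \<open>The loop invariant for one end component. A single member has to contain it, so that a
  maximal one finally coincides with that member.\<close>

definition captured ::
  "'x set set \<Rightarrow> ('x \<Rightarrow> 'uc set) \<Rightarrow> 'x set \<Rightarrow> ('x \<Rightarrow> 'uc set) \<Rightarrow> bool" where
  "captured \<C> D M E \<longleftrightarrow> (\<exists>N\<in>\<C>. M \<subseteq> N \<and> (\<forall>x\<in>M. E x \<subseteq> D x))"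

definition internal_actions :: "('x, 'uc, 'ua) game \<Rightarrow> 'x set \<Rightarrow> 'x \<Rightarrow> 'uc set" where
  "internal_actions Z N x = {u \<in> avC Z x. succs Z x u \<subseteq> N}"

text \<open>Stated for families so that it composes over visits; agreement of \<open>D'\<close> and
  \<open>D\<close> off \<open>\<Union>\<C>\<close> keeps visits from interfering. The last conjunct
  concerns members returned unchanged, which at a fixed point are all members.\<close>

definition round_spec ::
  "('x, 'uc, 'ua) game \<Rightarrow> 'x set set \<Rightarrow> ('x \<Rightarrow> 'uc set) \<Rightarrow>
   'x set set \<Rightarrow> ('x \<Rightarrow> 'uc set) \<Rightarrow> bool" where
  "round_spec Z \<C> D \<C>' D' \<longleftrightarrow>
     disjoint \<C>' \<and> (\<forall>N'\<in>\<C>'. N' \<noteq> {} \<and> (\<exists>N\<in>\<C>. N' \<subseteq> N)) \<and>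
     (\<forall>x. D' x \<subseteq> avC Z x) \<and> (\<forall>x. x \<notin> \<Union>\<C> \<longrightarrow> D' x = D x) \<and>
     (\<forall>M E. gec Z M E \<longrightarrow> captured \<C> D M E \<longrightarrow> captured \<C>' D' M E) \<and>
     (\<forall>N\<in>\<C> \<inter> \<C>'. strongly_connected N (digraph Z N D') \<and>
        (\<forall>x\<in>N. D' x = internal_actions Z N x))"

lemma round_spec_captured:
  "round_spec Z \<C> D \<C>' D' \<Longrightarrow> gec Z M E \<Longrightarrow> captured \<C> D M E \<Longrightarrow> captured \<C>' D' M E"
  unfolding round_spec_def by simp

text \<open>A captured end component lies inside one component \<open>X\<close> of the graph on
  \<open>N\<close>. Its actions stay in \<open>N\<close>, so they survive the recomputation and then
  the pruning, and \<open>N' \<inter> X\<close> captures it.\<close>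

lemma refine_round:
  assumes "valid_pick pick" "finite N" "\<And>x. D x \<subseteq> avC Z x"
  shows "\<exists>\<C>' D'. refine Z pick N (\<C>, D) = Some (\<C> \<union> \<C>', D') \<and> round_spec Z {N} D \<C>' D'"
proof -
  define SCCs where "SCCs = sccs N (digraph Z N D)"
  define D1 where "D1 = (\<lambda>x. if x \<in> \<Union>SCCs then internal_actions Z N x else D x)"
  define R where "R = {x \<in> \<Union>SCCs. D1 x = {}}"
  have SCCs: "X \<subseteq> N" "strongly_connected X (digraph Z N D)" if "X \<in> SCCs" for X
    using that unfolding SCCs_def sccs_def by auto
  have "R \<subseteq> N"
    using SCCs unfolding R_def by blast
  obtain N' D' where
    run: "prune Z pick R N D1 = Some (N', D')" and
    sub: "N' \<subseteq> N - R" and le: "\<And>x. D' x \<subseteq> D1 x" and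
    same: "\<And>x. x \<notin> N \<Longrightarrow> D' x = D1 x" and fix_D: "N' = N \<Longrightarrow> D' = D1" and
    cap: "\<And>M E. gec Z M E \<Longrightarrow> M \<subseteq> N - R \<Longrightarrow> (\<And>x. x \<in> M \<Longrightarrow> E x \<subseteq> D1 x) \<Longrightarrow>
       M \<subseteq> N' \<and> (\<forall>x\<in>M. E x \<subseteq> D' x)"
    using prune_terminates[OF assms(1,2) \<open>R \<subseteq> N\<close>, of Z D1] by metis
  define \<C>' where "\<C>' = {N' \<inter> X |X. X \<in> SCCs \<and> N' \<inter> X \<noteq> {}}"
  have "refine Z pick N (\<C>, D) = Some (\<C> \<union> \<C>', D')"
    using run unfolding refine_def Let_def SCCs_def D1_def R_def \<C>'_def internal_actions_def
    by simp
  moreover have "round_spec Z {N} D \<C>' D'"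
    unfolding round_spec_def
  proof (intro conjI allI impI ballI)
    show "disjoint \<C>'"
      using disjoint_sccs[of N "digraph Z N D"]
      unfolding disjoint_def \<C>'_def SCCs_def[symmetric] by blast
    show "Y \<noteq> {}" "\<exists>N\<in>{N}. Y \<subseteq> N" if "Y \<in> \<C>'" for Y
      using that sub unfolding \<C>'_def by blast+
    show "D' x \<subseteq> avC Z x" for x
      using le[of x] assms(3)[of x] unfolding D1_def internal_actions_def
      by (auto split: if_splits)
    show "D' x = D x" if "x \<notin> \<Union>{N}" for x
      using same[of x] that SCCs(1) unfolding D1_def by auto
    show "captured \<C>' D' M E" if gec: "gec Z M E" and "captured {N} D M E" for M E
    proof -
      have M: "M \<subseteq> N" "\<And>x. x \<in> M \<Longrightarrow> E x \<subseteq> D x"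
        using that unfolding captured_def by auto
      obtain X where X: "X \<in> SCCs" "M \<subseteq> X"
        using strongly_connected_subset_scc[OF assms(2) M(1)] gec_strongly_connected[OF gec M]
        unfolding SCCs_def by blast
      have D1: "E x \<subseteq> D1 x" if "x \<in> M" for x
      proof -
        have "x \<in> \<Union>SCCs"
          using X that by blast
        then show ?thesis
          using gec_succs[OF gec that] gec_avC[OF gec that] M(1)
          unfolding D1_def internal_actions_def by (simp add: subset_iff)
      qed
      moreover have "M \<inter> R = {}"
        using D1 gec_action_nonempty[OF gec] unfolding R_def by fastforce
      ultimately have "M \<subseteq> N'" "\<forall>x\<in>M. E x \<subseteq> D' x"
        using cap[OF gec] M(1) by blast+
      \<comment> \<open>Hence \<open>N' \<inter> X\<close> is not among the discarded empty
        intersections.\<close>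
      moreover have "M \<noteq> {}"
        using gec unfolding gec_def sub_dsg_def by blast
      ultimately have "N' \<inter> X \<in> \<C>'" "M \<subseteq> N' \<inter> X"
        using X unfolding \<C>'_def by blast+
      then show ?thesis
        using \<open>\<forall>x\<in>M. E x \<subseteq> D' x\<close> unfolding captured_def by blast
    qed
    fix Y
    assume "Y \<in> {N} \<inter> \<C>'"
    \<comment> \<open>\<open>N\<close> returns whole only if pruning removed nothing and
      \<open>N\<close> is itself a component. Then \<open>D\<close> was recomputed on all of
      \<open>N\<close>, and pruning left \<open>D1\<close> as it was.\<close>
    then obtain X where "Y = N" "X \<in> SCCs" "N = N' \<inter> X"
      unfolding \<C>'_def by blast
    then have "N' = N" "X = N"
      using sub SCCs(1)[of X] by auto
    then have "N \<in> SCCs"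
      using \<open>X \<in> SCCs\<close> by simp
    then have D': "D' x = internal_actions Z N x" if "x \<in> N" for x
      using fix_D \<open>N' = N\<close> that unfolding D1_def by auto
    then show "D' x = internal_actions Z Y x" if "x \<in> Y" for x
      using that \<open>Y = N\<close> by simp
    show "strongly_connected Y (digraph Z Y D')"
      unfolding \<open>Y = N\<close>
    proof (rule strongly_connected_mono[OF SCCs(2)[OF \<open>N \<in> SCCs\<close>]])
      \<comment> \<open>Strong connectivity was tested with the old map \<open>D\<close>. It carries
        over because \<open>digraph\<close> admits only actions staying in \<open>N\<close>, all of
        which belong to the recomputed map.\<close>
      show "digraph Z N D \<inter> N \<times> N \<subseteq> digraph Z N D'"
      proof -
        have "u \<in> D' x" if "x \<in> N" "u \<in> D x" "succs Z x u \<subseteq> N" for x u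
          using D'[OF that(1)] assms(3)[of x] that unfolding internal_actions_def by blast
        then show ?thesis
          unfolding digraph_def by blast
      qed
    qed
  qed
  ultimately show ?thesis
    by blast
qed

text \<open>The visits change the action map on disjoint sets of states, so the second preserves
  what the first established, and the first preserves what the second assumes.\<close>

lemma round_spec_Un:
  assumes 1: "round_spec Z \<C>1 D \<D>1 D1" and 2: "round_spec Z \<C>2 D1 \<D>2 D2"
    and disj: "\<Union>\<C>1 \<inter> \<Union>\<C>2 = {}"
  shows "round_spec Z (\<C>1 \<union> \<C>2) D (\<D>1 \<union> \<D>2) D2"
proof -
  have sub1: "N \<noteq> {}" "\<exists>N'\<in>\<C>1. N \<subseteq> N'" if "N \<in> \<D>1" for N
    using 1 that unfolding round_spec_def by auto
  have sub2: "N \<noteq> {}" "\<exists>N'\<in>\<C>2. N \<subseteq> N'" if "N \<in> \<D>2" for N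
    using 2 that unfolding round_spec_def by auto
  have D1: "D1 x = D x" if "x \<notin> \<Union>\<C>1" for x
    using 1 that unfolding round_spec_def by auto
  have D2: "D2 x = D1 x" if "x \<notin> \<Union>\<C>2" for x
    using 2 that unfolding round_spec_def by auto
  have D2': "D2 x = D1 x" if "N \<in> \<C>1" "x \<in> N" for N x
    using D2[of x] disj that by blast
  show ?thesis
    unfolding round_spec_def
  proof (intro conjI allI impI ballI)
    have "disjoint \<D>1" "disjoint \<D>2"
      using 1 2 unfolding round_spec_def by auto
    moreover have "\<Union>\<D>1 \<inter> \<Union>\<D>2 = {}"
      using sub1(2) sub2(2) disj by blast
    ultimately show "disjoint (\<D>1 \<union> \<D>2)"
      by (rule disjoint_union)
    show "N \<noteq> {}" "\<exists>N'\<in>\<C>1 \<union> \<C>2. N \<subseteq> N'" if "N \<in> \<D>1 \<union> \<D>2" for N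
      using that sub1[of N] sub2[of N] by auto
    show "D2 x \<subseteq> avC Z x" for x
      using 2 unfolding round_spec_def by auto
    show "D2 x = D x" if "x \<notin> \<Union>(\<C>1 \<union> \<C>2)" for x
      using that D1 D2 by auto
    show "captured (\<D>1 \<union> \<D>2) D2 M E"
      if gec: "gec Z M E" and cap: "captured (\<C>1 \<union> \<C>2) D M E" for M E
    proof -
      obtain N where N: "N \<in> \<C>1 \<union> \<C>2" "M \<subseteq> N" "\<forall>x\<in>M. E x \<subseteq> D x"
        using cap unfolding captured_def by blast
      show ?thesis
      proof (cases "N \<in> \<C>1")
        case True
        then have "captured \<D>1 D1 M E"
          using round_spec_captured[OF 1 gec] N unfolding captured_def[of \<C>1] by blast
        then show ?thesis
          using D2'[OF True] N(2) unfolding captured_def by (metis UnI1 subsetD)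
      next
        case False
        then have "N \<in> \<C>2"
          using N(1) by blast
        then have "D1 x = D x" if "x \<in> M" for x
          using D1[of x] disj N(2) that by blast
        then have "captured \<C>2 D1 M E"
          using \<open>N \<in> \<C>2\<close> N unfolding captured_def by auto
        then have "captured \<D>2 D2 M E"
          by (rule round_spec_captured[OF 2 gec])
        then show ?thesis
          unfolding captured_def by blast
      qed
    qed
    fix N
    assume N: "N \<in> (\<C>1 \<union> \<C>2) \<inter> (\<D>1 \<union> \<D>2)"
    then have "N \<noteq> {}"
      using sub1(1)[of N] sub2(1)[of N] by blast
    \<comment> \<open>A nonempty \<open>N\<close> in one input family cannot lie inside a member of
      the other, so it was returned by the visit that received it.\<close>
    then have cases: "N \<in> \<C>1 \<inter> \<D>1 \<or> N \<in> \<C>2 \<inter> \<D>2"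
      using N sub1(2)[of N] sub2(2)[of N] disj by blast
    have "strongly_connected N (digraph Z N D2) \<and> (\<forall>x\<in>N. D2 x = internal_actions Z N x)"
    proof (cases "N \<in> \<C>1 \<inter> \<D>1")
      case True
      moreover have "digraph Z N D2 = digraph Z N D1"
        using D2' True unfolding digraph_def by auto
      ultimately show ?thesis
        using 1 D2' unfolding round_spec_def by auto
    next
      case False
      then show ?thesis
        using 2 cases unfolding round_spec_def by blast
    qed
    then show "strongly_connected N (digraph Z N D2)"
      and "\<And>x. x \<in> N \<Longrightarrow> D2 x = internal_actions Z N x"
      by blast+
  qed
qed

text \<open>The accumulator \<open>\<C>\<close> stays arbitrary, so that the induction passes over
  the contributions of earlier visits.\<close>

lemma refine_all_round:
  assumes "valid_pick pick" "\<And>N. N \<in> set Ns \<Longrightarrow> finite N" "\<And>x. D x \<subseteq> avC Z x"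
    and "disjoint (set Ns)" "distinct Ns"
  shows "\<exists>\<C>' D'. refine_all Z pick Ns (\<C>, D) = Some (\<C> \<union> \<C>', D') \<and>
    round_spec Z (set Ns) D \<C>' D'"
  using assms(2-)
proof (induction Ns arbitrary: \<C> D)
  case Nil
  then show ?case
    by (auto simp: round_spec_def captured_def)
next
  case (Cons N Ns)
  obtain \<C>1 D1 where 1: "refine Z pick N (\<C>, D) = Some (\<C> \<union> \<C>1, D1)" "round_spec Z {N} D \<C>1 D1"
    using refine_round[OF assms(1)] Cons.prems by (metis list.set_intros(1))
  then have "D1 x \<subseteq> avC Z x" for x
    unfolding round_spec_def by blast
  moreover have "disjoint (set Ns)"
    using Cons.prems(3) by (auto simp: disjoint_def)
  ultimately obtain \<C>2 D2 where
    2: "refine_all Z pick Ns (\<C> \<union> \<C>1, D1) = Some ((\<C> \<union> \<C>1) \<union> \<C>2, D2)"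
      "round_spec Z (set Ns) D1 \<C>2 D2"
    using Cons.IH[of D1 "\<C> \<union> \<C>1"] Cons.prems(1,4) by (metis distinct.simps(2) list.set_intros(2))
  \<comment> \<open>\<open>distinct\<close> keeps \<open>N\<close> out of \<open>Ns\<close>;
    disjointness of the family does the rest.\<close>
  have "\<Union>{N} \<inter> \<Union>(set Ns) = {}"
    using Cons.prems(3,4) unfolding disjoint_def by auto
  from round_spec_Un[OF 1(2) 2(2) this]
  have "round_spec Z (set (N # Ns)) D (\<C>1 \<union> \<C>2) D2"
    by simp
  then show ?case
    using 1(1) 2(1) by (auto simp: Un_assoc)
qed

section \<open>The repeat loop\<close>

text \<open>For a disjoint family, the equivalence relation on its union whose classes are the
  nonempty members. Unlike the number of members, it cannot grow under refinement.\<close>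

definition same_member :: "'x set set \<Rightarrow> ('x \<times> 'x) set" where
  "same_member \<C> = (\<Union>N\<in>\<C>. N \<times> N)"

text \<open>
  Only the initial family can contain the empty set, namely when the game has no states; the
  intersection with \<open>{{}}\<close> accounts for it.
\<close>

definition loop_measure :: "'x set set \<Rightarrow> nat" where
  "loop_measure \<C> = card (same_member \<C>) + card (\<C> \<inter> {{}})"

text \<open>A nonempty member is recovered as the class of any of its elements.\<close>

lemma same_member_inject_subset:
  assumes "disjoint \<C>" "disjoint \<D>" "{} \<notin> \<C>" "same_member \<C> = same_member \<D>"
  shows "\<C> \<subseteq> \<D>"
proof
  fix N
  assume N: "N \<in> \<C>"
  then have "N \<noteq> {}"
    using assms(3) by metis
  then obtain x where x: "x \<in> N"
    by blast
  then have "(x, x) \<in> same_member \<D>"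
    using N assms(4) unfolding same_member_def by blast
  then obtain M where M: "M \<in> \<D>" "x \<in> M"
    unfolding same_member_def by blast
  have "y \<in> N \<longleftrightarrow> (x, y) \<in> same_member \<C>" for y
    using assms(1) N x unfolding same_member_def disjoint_def by blast
  moreover have "y \<in> M \<longleftrightarrow> (x, y) \<in> same_member \<D>" for y
    using assms(2) M unfolding same_member_def disjoint_def by blast
  ultimately have "N = M"
    using assms(4) by blast
  then show "N \<in> \<D>"
    using M by simp
qed

text \<open>Refinement shrinks the relation. If the relation stays equal, the families differ only
  by the empty set, which \<open>\<C>\<close> has and \<open>\<C>'\<close> lacks, so the second
  summand drops.\<close>

lemma loop_measure_decreases:
  assumes "disjoint \<C>" "disjoint \<C>'" "\<C>' \<noteq> \<C>" "finite (\<Union>\<C>)"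
    and "\<And>N'. N' \<in> \<C>' \<Longrightarrow> N' \<noteq> {} \<and> (\<exists>N\<in>\<C>. N' \<subseteq> N)"
  shows "loop_measure \<C>' < loop_measure \<C>"
proof -
  have sub: "same_member \<C>' \<subseteq> same_member \<C>"
  proof (rule subrelI)
    fix x y
    assume "(x, y) \<in> same_member \<C>'"
    then obtain N' where "N' \<in> \<C>'" "x \<in> N'" "y \<in> N'"
      unfolding same_member_def by blast
    then show "(x, y) \<in> same_member \<C>"
      using assms(5)[of N'] unfolding same_member_def by blast
  qed
  have "same_member \<C> \<subseteq> \<Union>\<C> \<times> \<Union>\<C>"
    unfolding same_member_def by blast
  then have fin: "finite (same_member \<C>)"
    using assms(4) by (meson finite_SigmaI finite_subset)
  have \<C>': "{} \<notin> \<C>'"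
    using assms(5)[of "{}"] by blast
  show ?thesis
  proof (cases "same_member \<C>' = same_member \<C>")
    case True
    then have "\<C>' \<subseteq> \<C>"
      by (rule same_member_inject_subset[OF assms(2,1) \<C>'])
    then have "{} \<in> \<C>"
      using same_member_inject_subset[OF assms(1,2) _ True[symmetric]] assms(3) by blast
    then show ?thesis
      using True \<C>' unfolding loop_measure_def by simp
  next
    case False
    then have "card (same_member \<C>') < card (same_member \<C>)"
      using sub fin by (meson psubsetI psubset_card_mono)
    then show ?thesis
      using \<C>' unfolding loop_measure_def by simp
  qed
qed

text \<open>\<open>D0\<close> is the action map on entry to the final round. That round returns its
  own family, so its contract describes every member.\<close>

lemma repeat_loop_terminates:
  assumes "valid_pick pick" "valid_visit visit"
    and "finite (\<Union>\<C>)" "disjoint \<C>" "\<And>x. D x \<subseteq> avC Z x"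
    and "\<And>M E. gec Z M E \<Longrightarrow> captured \<C> D M E"
  shows "\<exists>\<C>' D0 D'. repeat_loop Z pick visit \<C> D = Some (\<C>', D') \<and>
    \<Union>\<C>' \<subseteq> \<Union>\<C> \<and> round_spec Z \<C>' D0 \<C>' D' \<and> (\<forall>M E. gec Z M E \<longrightarrow> captured \<C>' D' M E)"
  using assms(3-)
proof (induction "loop_measure \<C>" arbitrary: \<C> D rule: less_induct)
  case less
  have "finite \<C>"
    using less.prems(1) finite_UnionD by blast
  then have visit: "set (visit \<C>) = \<C>" "distinct (visit \<C>)"
    using assms(2) unfolding valid_visit_def by auto
  have "finite N" if "N \<in> \<C>" for N
    using less.prems(1) that by (meson Union_upper finite_subset)
  then obtain \<C>' D' where
    run: "refine_all Z pick (visit \<C>) ({}, D) = Some (\<C>', D')" and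
    spec: "round_spec Z \<C> D \<C>' D'"
    using refine_all_round[OF assms(1), of "visit \<C>" D Z "{}"] visit less.prems(2,3) by auto
  have cap: "captured \<C>' D' M E" if "gec Z M E" for M E
    by (rule round_spec_captured[OF spec that less.prems(4)[OF that]])
  have step: "repeat_loop Z pick visit \<C> D =
    (if \<C> = \<C>' then Some (\<C>, D') else repeat_loop Z pick visit \<C>' D')"
    by (subst repeat_loop.simps) (simp add: run)
  show ?case
  proof (cases "\<C> = \<C>'")
    case True
    then show ?thesis
      using step spec cap by auto
  next
    case False
    have \<C>': "disjoint \<C>'" "\<And>N'. N' \<in> \<C>' \<Longrightarrow> N' \<noteq> {} \<and> (\<exists>N\<in>\<C>. N' \<subseteq> N)"
      "\<And>x. D' x \<subseteq> avC Z x"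
      using spec unfolding round_spec_def by auto
    have sub: "\<Union>\<C>' \<subseteq> \<Union>\<C>"
      using \<C>'(2) by blast
    have "loop_measure \<C>' < loop_measure \<C>"
      by (rule loop_measure_decreases[OF less.prems(2) \<C>'(1) not_sym[OF False] less.prems(1) \<C>'(2)])
    then have "\<exists>\<C>'' D0 D''. repeat_loop Z pick visit \<C>' D' = Some (\<C>'', D'') \<and>
      \<Union>\<C>'' \<subseteq> \<Union>\<C>' \<and> round_spec Z \<C>'' D0 \<C>'' D'' \<and>
      (\<forall>M E. gec Z M E \<longrightarrow> captured \<C>'' D'' M E)"
      by (rule less.hyps[OF _ finite_subset[OF sub less.prems(1)] \<C>'(1,3) cap])
    then show ?thesis
      unfolding step if_not_P[OF False] using subset_trans[OF _ sub] by metis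
  qed
qed

section \<open>Maximal end components of a stable family\<close>

text \<open>Members are end components by the last conjunct of the contract. An end component above
  a member is captured by that same member, by disjointness, hence equal to it. Conversely, a
  maximal one lies below the member capturing it, hence equals it.\<close>

lemma stable_family_gmecs:
  assumes "round_spec Z \<C> D0 \<C> D" "\<Union>\<C> \<subseteq> states Z"
    and cap: "\<And>M E. gec Z M E \<Longrightarrow> captured \<C> D M E"
  shows "{(N, restrict D N) |N. N \<in> \<C>} = {(N, D'). gmec Z N D'}"
proof -
  have disj: "disjoint \<C>" and nonempty: "\<And>N. N \<in> \<C> \<Longrightarrow> N \<noteq> {}"
    and stable: "\<And>N. N \<in> \<C> \<Longrightarrow> strongly_connected N (digraph Z N D)"
      "\<And>N x. N \<in> \<C> \<Longrightarrow> x \<in> N \<Longrightarrow> D x = internal_actions Z N x"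
    using assms(1) unfolding round_spec_def by simp_all
  have gec: "gec Z N (restrict D N)" if N: "N \<in> \<C>" for N
  proof -
    have "digraph Z N (restrict D N) = digraph Z N D"
      unfolding digraph_def by auto
    moreover have "sub_dsg Z N (restrict D N)"
      using nonempty[OF N] stable(2)[OF N] assms(2) N
      unfolding sub_dsg_def internal_actions_def by auto
    ultimately show ?thesis
      using stable(1)[OF N] unfolding gec_def by simp
  qed
  \<comment> \<open>Action maps are extensional, so agreement on \<open>N\<close> gives equality;
    this is why \<open>D\<close> is restricted to \<open>N\<close>.\<close>
  have ext: "D' \<in> extensional N" if "gec Z N D'" for N D'
    using that unfolding gec_def sub_dsg_def PiE_def by blast
  have "gmec Z N (restrict D N)" if N: "N \<in> \<C>" for N
    unfolding gmec_def
  proof (intro conjI notI gec N; elim exE conjE)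
    fix N' D'
    assume *: "gec Z N' D'" "(N', D') \<noteq> (N, restrict D N)" "N \<subseteq> N'"
      "\<forall>x\<in>N. restrict D N x \<subseteq> D' x"
    obtain M where M: "M \<in> \<C>" "N' \<subseteq> M" "\<forall>x\<in>N'. D' x \<subseteq> D x"
      using cap[OF *(1)] unfolding captured_def by blast
    have "M = N"
      using disjointD[OF disj M(1) N] nonempty[OF N] M(2) *(3) by blast
    then have "N' = N"
      using M *(3) by blast
    moreover have "D' = restrict D N"
    proof (rule extensionalityI)
      show "D' \<in> extensional N"
        using ext[OF *(1)] \<open>N' = N\<close> by simp
    qed (use M *(4) \<open>N' = N\<close> in auto)
    ultimately show False
      using *(2) by simp
  qed
  moreover have "\<exists>M\<in>\<C>. (N, D') = (M, restrict D M)" if "gmec Z N D'" for N D'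
  proof -
    have "gec Z N D'"
      using that unfolding gmec_def by blast
    then obtain M where M: "M \<in> \<C>" "N \<subseteq> M" "\<forall>x\<in>N. D' x \<subseteq> D x"
      using cap unfolding captured_def by blast
    then have "\<forall>x\<in>N. D' x \<subseteq> restrict D M x"
      by auto
    then have "(M, restrict D M) = (N, D')"
      using that gec[OF M(1)] M(2) unfolding gmec_def by blast
    then show ?thesis
      using M(1) by auto
  qed
  ultimately show ?thesis
    by blast
qed

theorem compute_gamec_correct:
  assumes "finite (states Z)" "valid_pick pick" "valid_visit visit"
  shows "\<exists>\<C> D. compute_gamec Z pick visit = Some (\<C>, D) \<and>
           {(N, restrict D N) |N. N \<in> \<C>} = {(N, D'). gamec Z N D'}"
proof -
  \<comment> \<open>The initial family and action map impose no restriction, so the invariant holds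
    on entry.\<close>
  have "captured {states Z} (avC Z) M E" if "gec Z M E" for M E
  proof -
    have "M \<subseteq> states Z"
      using that unfolding gec_def sub_dsg_def by simp
    then show ?thesis
      using gec_avC[OF that] unfolding captured_def by simp
  qed
  then obtain \<C> D0 D where
    run: "repeat_loop Z pick visit {states Z} (avC Z) = Some (\<C>, D)" and
    sub: "\<Union>\<C> \<subseteq> states Z" and spec: "round_spec Z \<C> D0 \<C> D" and
    cap: "\<And>M E. gec Z M E \<Longrightarrow> captured \<C> D M E"
    using repeat_loop_terminates[OF assms(2,3), of "{states Z}" "avC Z" Z] assms(1)
    by (simp add: disjoint_def) metis
  have "{(N, restrict D N) |N. N \<in> \<C>} = {(N, D'). gmec Z N D'}"
    by (rule stable_family_gmecs[OF spec sub cap])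
  \<comment> \<open>The final filter looks only at \<open>N\<close>, so it commutes with attaching
    the restricted maps.\<close>
  moreover have "{(N, restrict D N) |N. N \<in> {N \<in> \<C>. acc Z \<inter> N \<noteq> {}}} =
      {(N, restrict D N) |N. N \<in> \<C>} \<inter> {(N, D'). acc Z \<inter> N \<noteq> {}}"
    by blast
  ultimately have "{(N, restrict D N) |N. N \<in> {N \<in> \<C>. acc Z \<inter> N \<noteq> {}}} = {(N, D'). gamec Z N D'}"
    unfolding gamec_def by auto
  moreover have "compute_gamec Z pick visit = Some ({N \<in> \<C>. acc Z \<inter> N \<noteq> {}}, D)"
    unfolding compute_gamec_def by (simp add: run)
  ultimately show ?thesis
    by blast
qed

theorem proposition2:
  fixes A :: "('q, 'p, 'c) tba"
    and G :: "('s, 'uc, 'ua, 'p, 'c) dsg"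
    and V :: "('c \<Rightarrow> real) set"
    and K :: "('s, 'q, 'c, 'l, 'uc) fsc"
    and \<xi> :: "('c \<Rightarrow> real) \<Rightarrow> ('c \<Rightarrow> real) pmf"
    and Z :: "(('s, 'q, 'c) pstate \<times> ('l \<times> bool), 'uc, 'ua) game"
  assumes "gdsg_data A G V K \<xi>"
    and "Z = gdsg A G V K \<xi>"
    and "valid_pick pick"
    and "valid_visit visit"
  shows "\<exists>\<C> D. compute_gamec Z pick visit = Some (\<C>, D) \<and>
           {(N, restrict D N) |N. N \<in> \<C>} = {(N, D'). gamec Z N D'}"
proof (rule compute_gamec_correct[OF _ assms(3,4)])
  \<comment> \<open>Global states form a product of finite factors: game states, locations,
    \<open>V\<close>, estimates and the detection bit.\<close>
  show "finite (states Z)"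
    using assms(1) unfolding assms(2)
    by (simp add: gdsg_data_def is_tba_def is_dsg_def is_fsc_def gdsg_def pdsg_def internal_def)
qed

end
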